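(* Let $n\geq 2$ be an integer and let $K$ be an infinite field such that $\mathrm{char}(K)\neq 2$. Let $A\in\mathcal{M}_n(K)$ be such that $\mathrm{rank}(A)\geq n/2$. Then there exists $B\in\mathcal{M}_n(K)$ such that $B$ is similar to $A$ (over $K$) and $A+B$ is invertible.
   Context: $\mathcal{M}_n(K)$ denotes the set of $n\times n$ matrices with entries in $K$. "$B$ is similar to $A$" means $B=PAP^{-1}$ for some $P\in GL_n(K)$. *)

theory Defs
  imports Complex_Main "Jordan_Normal_Form.DL_Rank"
begin

end

theory Submission
  imports Defs "Jordan_Normal_Form.Column_Operations"
begin

text \<open>
  Writing \<open>B = P A P\<^sup>-\<^sup>1\<close>, invertibility of \<open>A + B\<close> means invertibility of \<open>A P + P A\<close>. As this is
  linear in \<open>P\<close>, over an infinite field any \<open>X\<close> with \<open>det (A X + X A) \<noteq> 0\<close> can be moved to an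
  invertible \<open>P = X + u I\<close>. Up to similarity \<open>A = D C\<close> with \<open>D = diag(I\<^sub>r, 0)\<close> and \<open>C\<close> invertible; put
  \<open>m = n - r \<le> r\<close>. Perturb the identity, \<open>X = I + s X\<^sub>0\<close>: the lowest-order coefficient in \<open>s\<close> of
  \<open>det (A X + X A)\<close> is, up to a nonzero factor, the determinant of \<open>X\<^sub>0 A X\<^sub>0\<close> compressed to a map from the
  kernel to the cokernel of \<open>A\<close>. Taking \<open>X\<^sub>0\<close> as a product of an \<open>n \<times> m\<close> and an \<open>m \<times> n\<close> matrix splits this
  determinant into three \<open>m \<times> m\<close> determinants, each of which is generically nonzero; for the one
  involving \<open>A\<close> this is where \<open>m \<le> r\<close> enters.
\<close>

section \<open>Singular values of a linear pencil\<close>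

text \<open>The polynomial is the determinant of the pencil formed over the polynomial ring;
  evaluation at \<open>t\<close> is a ring homomorphism and therefore commutes with
  \<open>det\<close>.\<close>

lemma poly_det_pencil:
  fixes P Q :: "'k :: comm_ring_1 mat"
  assumes P: "P \<in> carrier_mat n n" and Q: "Q \<in> carrier_mat n n"
  obtains p where "\<And>t. poly p t = det (P + t \<cdot>\<^sub>m Q)"
proof
  fix t :: "'k"
  interpret comm_ring_hom "\<lambda>p. poly p t" by unfold_locales auto
  have "poly (det (map_mat (\<lambda>a. [:a:]) P + [:0, 1:] \<cdot>\<^sub>m map_mat (\<lambda>a. [:a:]) Q)) t
      = det (map_mat (\<lambda>p. poly p t) (map_mat (\<lambda>a. [:a:]) P + [:0, 1:] \<cdot>\<^sub>m map_mat (\<lambda>a. [:a:]) Q))"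
    by (rule hom_det[symmetric])
  also have "map_mat (\<lambda>p. poly p t) (map_mat (\<lambda>a. [:a:]) P + [:0, 1:] \<cdot>\<^sub>m map_mat (\<lambda>a. [:a:]) Q)
      = P + t \<cdot>\<^sub>m Q"
    by (rule eq_matI) (use P Q in auto)
  finally show "poly (det (map_mat (\<lambda>a. [:a:]) P + [:0, 1:] \<cdot>\<^sub>m map_mat (\<lambda>a. [:a:]) Q)) t
      = det (P + t \<cdot>\<^sub>m Q)" .
qed

text \<open>The determinant is a polynomial in \<open>t\<close> whose value at \<open>0\<close> is
  \<open>det P\<close>, so it is not the zero polynomial. Over an infinite field, finitely many such
  conditions can be avoided by a single \<open>t\<close>; every generic choice below is made in this
  way.\<close>

lemma finite_singular_pencil:
  fixes P Q :: "'k :: idom mat"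
  assumes P: "P \<in> carrier_mat n n" and Q: "Q \<in> carrier_mat n n" and "det P \<noteq> 0"
  shows "finite {t. det (P + t \<cdot>\<^sub>m Q) = 0}"
proof -
  obtain p where p: "\<And>t. poly p t = det (P + t \<cdot>\<^sub>m Q)"
    using poly_det_pencil[OF P Q] by blast
  have "P + 0 \<cdot>\<^sub>m Q = P"
    by (rule eq_matI) (use P Q in auto)
  then have "poly p 0 \<noteq> 0"
    using p assms(3) by simp
  then have "p \<noteq> 0" by auto
  then show ?thesis
    using poly_roots_finite[of p] p by simp
qed

text \<open>For nonzero \<open>t\<close>, dividing by \<open>t\<close> exchanges the roles of
  \<open>P\<close> and \<open>Q\<close> and replaces \<open>t\<close> by its inverse;
  \<open>t = 0\<close> is the one value to be added by hand.\<close>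

lemma finite_singular_pencil_leading:
  fixes P Q :: "'k :: field mat"
  assumes P: "P \<in> carrier_mat n n" and Q: "Q \<in> carrier_mat n n" and "det Q \<noteq> 0"
  shows "finite {t. det (P + t \<cdot>\<^sub>m Q) = 0}"
proof (rule finite_subset)
  show "finite (insert 0 (inverse ` {t. det (Q + t \<cdot>\<^sub>m P) = 0}))"
    using finite_singular_pencil[OF Q P assms(3)] by simp
  show "{t. det (P + t \<cdot>\<^sub>m Q) = 0} \<subseteq> insert 0 (inverse ` {t. det (Q + t \<cdot>\<^sub>m P) = 0})"
  proof
    fix t assume t: "t \<in> {t. det (P + t \<cdot>\<^sub>m Q) = 0}"
    show "t \<in> insert 0 (inverse ` {t. det (Q + t \<cdot>\<^sub>m P) = 0})"
    proof (cases "t = 0")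
      case False
      have "Q + inverse t \<cdot>\<^sub>m P = inverse t \<cdot>\<^sub>m (P + t \<cdot>\<^sub>m Q)"
        by (rule eq_matI) (use P Q False in \<open>auto simp: field_simps\<close>)
      then have "det (Q + inverse t \<cdot>\<^sub>m P) = 0"
        using t by simp
      then show ?thesis
        by (intro insertI2 image_eqI[of _ _ "inverse t"]) auto
    qed simp
  qed
qed

section \<open>Rank of products\<close>

text \<open>Every column of \<open>C * E\<close> is \<open>C\<close> applied to a vector, so the
  column space of the product lies in that of \<open>C\<close>.\<close>

lemma (in vec_space) rank_mult_le:
  fixes C :: "'a mat"
  assumes C: "C \<in> carrier_mat n k" and E: "E \<in> carrier_mat k l"
  shows "rank (C * E) \<le> rank C"
proof -
  have CE: "C * E \<in> carrier_mat n l" using C E by auto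
  have cols: "set (cols C) \<subseteq> carrier_vec n" "set (cols (C * E)) \<subseteq> carrier_vec n"
    using cols_dim C CE by blast+
  have "set (cols (C * E)) \<subseteq> span (set (cols C))"
  proof
    fix x assume "x \<in> set (cols (C * E))"
    then obtain j where "j < l" "x = col (C * E) j"
      using CE E by (auto simp: cols_def)
    then have "x = C *\<^sub>v col E j" using C E by (auto simp: col_mult2)
    moreover have "C *\<^sub>v col E j \<in> carrier_vec (dim_row C)" "col E j \<in> carrier_vec (dim_col C)"
      using C E by auto
    ultimately show "x \<in> span (set (cols C))"
      unfolding col_space_def[symmetric] col_space_eq[OF C] by blast
  qed
  then have sub: "span (set (cols (C * E))) \<subseteq> span (set (cols C))"
    by (rule span_subsetI[OF cols(1)])
  have "subspace class_ring (span (set (cols (C * E)))) (span_vs (set (cols C)))"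
    by (rule nested_subspaces[OF span_is_subspace[OF cols(1)] span_is_subspace[OF cols(2)] sub])
  then show ?thesis
    unfolding rank_def
    using vectorspace.subspace_dim[OF subspace_is_vs[OF span_is_subspace[OF cols(1)]] _ fin_dim_span_cols[OF C]]
      fin_dim_span_cols[OF CE] by simp
qed

definition unit_block :: "nat \<Rightarrow> nat \<Rightarrow> 'k :: field mat" where
  "unit_block r m = four_block_mat (1\<^sub>m r) (0\<^sub>m r m) (0\<^sub>m m r) (0\<^sub>m m m)"

lemma unit_block_carrier [simp]: "unit_block r m \<in> carrier_mat (r + m) (r + m)"
  unfolding unit_block_def by simp

text \<open>The block factors as \<open>J * K\<close> through dimension \<open>r\<close>, so the
  whole product starts with \<open>U * J\<close>, which has only \<open>r\<close> columns.\<close>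

lemma rank_unit_block_le:
  fixes U V :: "'k :: field mat"
  assumes U: "U \<in> carrier_mat (r + m) (r + m)" and V: "V \<in> carrier_mat (r + m) l"
  shows "vec_space.rank (r + m) (U * unit_block r m * V) \<le> r"
proof -
  interpret vec_space "TYPE('k)" "r + m" .
  \<comment> \<open>The blocks of width and height \<open>0\<close> give \<open>J\<close> and
    \<open>K\<close> the four-block shape that block multiplication expects, with inner dimension
    \<open>r + 0\<close>.\<close>
  define J :: "'k mat" where "J = four_block_mat (1\<^sub>m r) (0\<^sub>m r 0) (0\<^sub>m m r) (0\<^sub>m m 0)"
  define K :: "'k mat" where "K = four_block_mat (1\<^sub>m r) (0\<^sub>m r m) (0\<^sub>m 0 r) (0\<^sub>m 0 m)"
  have J: "J \<in> carrier_mat (r + m) (r + 0)" unfolding J_def by (rule four_block_carrier_mat) auto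
  have K: "K \<in> carrier_mat (r + 0) (r + m)" unfolding K_def by (rule four_block_carrier_mat) auto
  have "J * K = unit_block r m"
    unfolding J_def K_def unit_block_def
    by (subst mult_four_block_mat[of _ r r _ 0 _ m _ _ r _ m]) auto
  then have "U * unit_block r m * V = (U * J) * (K * V)"
    using assoc_mult_mat[OF U J K] assoc_mult_mat[of "U * J" "r + m" r K "r + m" V l] U V J K by simp
  then have "rank (U * unit_block r m * V) \<le> rank (U * J)"
    using rank_mult_le[OF mult_carrier_mat[OF U J] mult_carrier_mat[OF K V]] by simp
  also have "\<dots> \<le> r"
    using rank_le_nc[of "U * J" r] U J by simp
  finally show ?thesis .
qed

section \<open>Elimination to the rank normal form under equivalence\<close>

lemma obtain_inverse_mat:
  fixes A :: "'k :: field mat"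
  assumes A: "A \<in> carrier_mat n n" and "det A \<noteq> 0"
  obtains B where "B \<in> carrier_mat n n" "A * B = 1\<^sub>m n" "B * A = 1\<^sub>m n"
  using det_non_zero_imp_unit[OF assms, of "()"] unfolding Units_def ring_mat_def by auto

lemma invertible_mat_if_det_nonzero:
  fixes M :: "'k :: field mat"
  assumes M: "M \<in> carrier_mat n n" and "det M \<noteq> 0"
  shows "invertible_mat M"
  using obtain_inverse_mat[OF assms] M unfolding invertible_mat_def inverts_mat_def
  by (metis carrier_matD square_mat.simps)

text \<open>One step of block elimination: \<open>U\<close> scales the pivot to \<open>1\<close> and
  clears the column below it, \<open>V\<close> clears the row to its right, and \<open>A'\<close> is
  the Schur complement of the pivot.\<close>

lemma clear_pivot:
  fixes A :: "'k :: field mat"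
  assumes A: "A \<in> carrier_mat (Suc n) (Suc n)" and "A $$ (0, 0) \<noteq> 0"
  obtains U V A' where "U \<in> carrier_mat (Suc n) (Suc n)" "V \<in> carrier_mat (Suc n) (Suc n)"
    "det U \<noteq> 0" "det V \<noteq> 0" "A' \<in> carrier_mat n n"
    "U * A * V = four_block_mat (1\<^sub>m 1) (0\<^sub>m 1 n) (0\<^sub>m n 1) A'"
proof -
  obtain a b c d where "split_block A 1 1 = (a, b, c, d)"
    by (cases "split_block A 1 1") auto
  note s = split_block[OF this, of n n]
  have abcd: "a \<in> carrier_mat 1 1" "b \<in> carrier_mat 1 n" "c \<in> carrier_mat n 1" "d \<in> carrier_mat n n"
    and A_eq: "A = four_block_mat a b c d"
    using s A by auto
  have "det a = A $$ (0, 0)"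
    using abcd by (simp add: A_eq det_single)
  then have "det a \<noteq> 0" using assms(2) by simp
  then obtain a' where a': "a' \<in> carrier_mat 1 1" "a * a' = 1\<^sub>m 1" "a' * a = 1\<^sub>m 1"
    using obtain_inverse_mat[OF abcd(1)] by metis
  have "det a' \<noteq> 0"
    using det_mult[OF abcd(1) a'(1)] a'(2) by auto
  define U where "U = four_block_mat a' (0\<^sub>m 1 n) (- (c * a')) (1\<^sub>m n)"
  define V where "V = four_block_mat (1\<^sub>m 1) (- (a' * b)) (0\<^sub>m n 1) (1\<^sub>m n)"
  have UA: "U * A = four_block_mat (1\<^sub>m 1) (a' * b) (0\<^sub>m n 1) (d - c * (a' * b))"
    unfolding U_def A_eq using abcd a'
    by (subst mult_four_block_mat[of _ 1 1 _ n _ n _ _ 1 _ n])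
      (auto intro!: cong_four_block_mat)
  show ?thesis
  proof
    show "U \<in> carrier_mat (Suc n) (Suc n)" "V \<in> carrier_mat (Suc n) (Suc n)"
      unfolding U_def V_def using four_block_carrier_mat[OF a'(1) one_carrier_mat[of n]]
        four_block_carrier_mat[OF one_carrier_mat[of 1] one_carrier_mat[of n]] by auto
    show "det U \<noteq> 0" unfolding U_def
      using det_four_block_mat_upper_right_zero[OF a'(1) refl _ one_carrier_mat[of n]] abcd a' \<open>det a' \<noteq> 0\<close> by simp
    show "det V \<noteq> 0" unfolding V_def
      using det_four_block_mat_lower_left_zero[OF one_carrier_mat[of 1]
          uminus_carrier_mat[OF mult_carrier_mat[OF a'(1) abcd(2)]] refl one_carrier_mat[of n]] by simp
    show "d - c * (a' * b) \<in> carrier_mat n n"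
      using mult_carrier_mat[OF abcd(3) mult_carrier_mat[OF a'(1) abcd(2)]] by (rule minus_carrier_mat)
    show "U * A * V = four_block_mat (1\<^sub>m 1) (0\<^sub>m 1 n) (0\<^sub>m n 1) (d - c * (a' * b))"
      unfolding UA V_def using abcd a'
      by (subst mult_four_block_mat[of _ 1 1 _ n _ n _ _ 1 _ n])
        (auto intro!: cong_four_block_mat)
  qed
qed

text \<open>One row swap and one column swap bring a nonzero entry to the top left. Swap matrices
  are their own inverses, hence have nonzero determinant.\<close>

lemma move_pivot:
  fixes A :: "'k :: field mat"
  assumes A: "A \<in> carrier_mat n n" and "A \<noteq> 0\<^sub>m n n"
  obtains U V where "U \<in> carrier_mat n n" "V \<in> carrier_mat n n"
    "det U \<noteq> 0" "det V \<noteq> 0" "(U * A * V) $$ (0, 0) \<noteq> 0"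
proof -
  obtain i j where ij: "i < n" "j < n" "A $$ (i, j) \<noteq> 0"
    using assms by (metis eq_matI carrier_matD index_zero_mat)
  define U :: "'k mat" where "U = swaprows_mat n 0 i"
  define V :: "'k mat" where "V = swaprows_mat n 0 j"
  have c: "U \<in> carrier_mat n n" "V \<in> carrier_mat n n" unfolding U_def V_def by auto
  have "U * U = 1\<^sub>m n" "V * V = 1\<^sub>m n"
    unfolding U_def V_def using ij by (auto intro!: swaprows_mat_inv)
  then have "det U \<noteq> 0" "det V \<noteq> 0"
    using det_mult[OF c(1) c(1)] det_mult[OF c(2) c(2)] by auto
  moreover have "swaprows 0 i A \<in> carrier_mat n n"
    using A by simp
  then have "U * A * V = swapcols 0 j (swaprows 0 i A)"
    using swaprows_mat[OF A, of 0 i] swapcols_mat[of "swaprows 0 i A" n n 0 j] ij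
    unfolding U_def V_def by simp
  ultimately show ?thesis
    using that[OF c] ij A by auto
qed

text \<open>Induction on the size: a nonzero matrix is given a pivot, its row and column are
  cleared, and the remaining block is treated recursively; a zero matrix stops the recursion with
  \<open>r = 0\<close>.\<close>

lemma equivalent_unit_block:
  fixes A :: "'k :: field mat"
  assumes "A \<in> carrier_mat n n"
  obtains U V r m where "n = r + m" "U \<in> carrier_mat n n" "V \<in> carrier_mat n n"
    "det U \<noteq> 0" "det V \<noteq> 0" "U * A * V = unit_block r m"
proof -
  have "\<exists>U V r m. n = r + m \<and> U \<in> carrier_mat n n \<and> V \<in> carrier_mat n n \<and>
    det U \<noteq> 0 \<and> det V \<noteq> 0 \<and> U * A * V = unit_block r m"
    using assms
  proof (induction n arbitrary: A)
    case 0
    then show ?case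
      by (intro exI[of _ "1\<^sub>m 0"] exI[of _ 0]) (auto simp: unit_block_def)
  next
    case (Suc n)
    show ?case
    proof (cases "A = 0\<^sub>m (Suc n) (Suc n)")
      case True
      then show ?thesis
        by (intro exI[of _ "1\<^sub>m (Suc n)"] exI[of _ 0] exI[of _ "Suc n"]) (auto simp: unit_block_def)
    next
      case False
      obtain U1 V1 where 1: "U1 \<in> carrier_mat (Suc n) (Suc n)" "V1 \<in> carrier_mat (Suc n) (Suc n)"
        "det U1 \<noteq> 0" "det V1 \<noteq> 0" "(U1 * A * V1) $$ (0, 0) \<noteq> 0"
        using move_pivot[OF Suc.prems False] by metis
      obtain U2 V2 A' where 2: "U2 \<in> carrier_mat (Suc n) (Suc n)" "V2 \<in> carrier_mat (Suc n) (Suc n)"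
        "det U2 \<noteq> 0" "det V2 \<noteq> 0" "A' \<in> carrier_mat n n"
        "U2 * (U1 * A * V1) * V2 = four_block_mat (1\<^sub>m 1) (0\<^sub>m 1 n) (0\<^sub>m n 1) A'"
        using clear_pivot[of "U1 * A * V1" n] 1 Suc.prems by (metis mult_carrier_mat)
      obtain U3 V3 r m where 3: "n = r + m" "U3 \<in> carrier_mat n n" "V3 \<in> carrier_mat n n"
        "det U3 \<noteq> 0" "det V3 \<noteq> 0" "U3 * A' * V3 = unit_block r m"
        using Suc.IH[OF 2(5)] by metis
      \<comment> \<open>Bordering by a pivot \<open>1\<close> is multiplicative and keeps the
        determinant, so the transformations found for \<open>A'\<close> extend without disturbing
        the pivot.\<close>
      let ?B = "\<lambda>X. four_block_mat (1\<^sub>m 1) (0\<^sub>m 1 n) (0\<^sub>m n 1) X :: 'k mat"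
      have B: "?B X \<in> carrier_mat (Suc n) (Suc n)" "det (?B X) = det X" if "X \<in> carrier_mat n n" for X
        using that four_block_carrier_mat[OF one_carrier_mat[of 1] that]
          det_four_block_mat_upper_right_zero[OF one_carrier_mat[of 1] refl _ that] by auto
      have mult: "?B X * ?B Y = ?B (X * Y)" if "X \<in> carrier_mat n n" "Y \<in> carrier_mat n n" for X Y
        using that by (subst mult_four_block_mat[of _ 1 1 _ n _ n _ _ 1 _ n]) auto
      have "?B U3 * (U2 * (U1 * A * V1) * V2) * ?B V3 = ?B (unit_block r m)"
        using 2(5) 3(2,3) by (simp only: 2(6) mult mult_carrier_mat[of _ n n _ n] 3(6))
      also have "\<dots> = unit_block (Suc r) m"
        unfolding unit_block_def by (rule eq_matI) (auto simp: 3(1))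
      also have "?B U3 * (U2 * (U1 * A * V1) * V2) * ?B V3 = (?B U3 * U2 * U1) * A * (V1 * V2 * ?B V3)"
        using 1(1,2) 2(1,2) Suc.prems B(1)[OF 3(2)] B(1)[OF 3(3)]
        by (simp add: assoc_mult_mat[of _ "Suc n" "Suc n" _ "Suc n" _ "Suc n"])
      finally have "(?B U3 * U2 * U1) * A * (V1 * V2 * ?B V3) = unit_block (Suc r) m" .
      moreover have "det (?B U3 * U2 * U1) \<noteq> 0" "det (V1 * V2 * ?B V3) \<noteq> 0"
        using 1 2 3 B[OF 3(2)] B[OF 3(3)]
        by (simp_all add: det_mult[of _ "Suc n"])
      moreover have "?B U3 * U2 * U1 \<in> carrier_mat (Suc n) (Suc n)"
        "V1 * V2 * ?B V3 \<in> carrier_mat (Suc n) (Suc n)"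
        using 1 2 B[OF 3(2)] B[OF 3(3)] by auto
      ultimately show ?thesis
        using 3(1) by (metis add_Suc)
    qed
  qed
  then show ?thesis using that by blast
qed

section \<open>The lowest-order coefficient in \<open>s\<close>\<close>

text \<open>Taking a factor \<open>s\<close> out of each of the last \<open>m\<close> rows and
  columns leaves the pencil \<open>P + s Q\<close>. At \<open>s = 0\<close> this is
  \<open>P\<close>, whose determinant is \<open>det (2 I)\<close> times that of the Schur complement
  \<open>- (1/2) Z Y\<close>.\<close>

lemma det_bordered_pencil:
  fixes E :: "'k :: field mat"
  assumes inf: "infinite (UNIV :: 'k set)" and two: "(2 :: 'k) \<noteq> 0"
    and E: "E \<in> carrier_mat r r" and Y: "Y \<in> carrier_mat r m" and Z: "Z \<in> carrier_mat m r"
    and "det (Z * Y) \<noteq> 0"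
  obtains s where "det (four_block_mat (2 \<cdot>\<^sub>m 1\<^sub>m r + s \<cdot>\<^sub>m E) (s \<cdot>\<^sub>m Y) (s \<cdot>\<^sub>m Z) (0\<^sub>m m m)) \<noteq> 0"
proof -
  define P where "P = four_block_mat (2 \<cdot>\<^sub>m 1\<^sub>m r) Y Z (0\<^sub>m m m)"
  define Q where "Q = four_block_mat E (0\<^sub>m r m) (0\<^sub>m m r) (0\<^sub>m m m)"
  \<comment> \<open>Column operation that clears the upper right block of \<open>P\<close> and
    produces the Schur complement below it; this is where \<open>2 \<noteq> 0\<close>
    enters.\<close>
  define T where "T = four_block_mat (1\<^sub>m r) ((- 1 / 2) \<cdot>\<^sub>m Y) (0\<^sub>m m r) (1\<^sub>m m)"
  have P: "P \<in> carrier_mat (r + m) (r + m)" unfolding P_def by (rule four_block_carrier_mat) auto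
  have Q: "Q \<in> carrier_mat (r + m) (r + m)" unfolding Q_def by (rule four_block_carrier_mat) (use E in auto)
  have T: "T \<in> carrier_mat (r + m) (r + m)" unfolding T_def by (rule four_block_carrier_mat) auto
  have ZY: "Z * Y \<in> carrier_mat m m" using Y Z by simp
  have "(2 \<cdot>\<^sub>m 1\<^sub>m r) * ((- 1 / 2) \<cdot>\<^sub>m Y) = - Y"
    using Y two by (intro eq_matI) (auto simp: mult_smult_assoc_mat[of _ r r])
  then have "P * T = four_block_mat (2 \<cdot>\<^sub>m 1\<^sub>m r) (0\<^sub>m r m) Z ((- 1 / 2) \<cdot>\<^sub>m (Z * Y))"
    unfolding P_def T_def using Y Z
    by (subst mult_four_block_mat[of _ r r _ m _ m _ _ r _ m])
      (auto intro!: cong_four_block_mat simp: mult_smult_distrib[of _ m r])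
  then have "det (P * T) = det (2 \<cdot>\<^sub>m 1\<^sub>m r :: 'k mat) * det ((- 1 / 2) \<cdot>\<^sub>m (Z * Y))"
    using det_four_block_mat_upper_right_zero[OF smult_carrier_mat[OF one_carrier_mat[of r], of 2]
        refl Z smult_carrier_mat[OF ZY, of "- 1 / 2"]] by simp
  also have "\<dots> \<noteq> 0"
    using assms(6) two by simp
  finally have "det P \<noteq> 0"
    using det_mult[OF P T] by auto
  \<comment> \<open>The value \<open>0\<close> is excluded as well, because the factors
    \<open>s\<close> are to be put back by an invertible matrix.\<close>
  then have "finite (insert 0 {t. det (P + t \<cdot>\<^sub>m Q) = 0})"
    using finite_singular_pencil[OF P Q] by simp
  then obtain s where s: "s \<noteq> 0" "det (P + s \<cdot>\<^sub>m Q) \<noteq> 0"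
    using ex_new_if_finite[OF inf] by (metis (mono_tags, lifting) insertCI mem_Collect_eq)
  \<comment> \<open>Multiplying on both sides by \<open>K\<close> restores the factors \<open>s\<close>, which were removed to make the pencil regular at \<open>s = 0\<close>.\<close>
  define K :: "'k mat" where "K = four_block_mat (1\<^sub>m r) (0\<^sub>m r m) (0\<^sub>m m r) (s \<cdot>\<^sub>m 1\<^sub>m m)"
  have K: "K \<in> carrier_mat (r + m) (r + m)" unfolding K_def by (rule four_block_carrier_mat) auto
  have "det K = det (1\<^sub>m r :: 'k mat) * det (s \<cdot>\<^sub>m 1\<^sub>m m :: 'k mat)"
    unfolding K_def by (rule det_four_block_mat_upper_right_zero) auto
  then have dK: "det K \<noteq> 0" using s(1) by simp
  have PQ: "P + s \<cdot>\<^sub>m Q = four_block_mat (2 \<cdot>\<^sub>m 1\<^sub>m r + s \<cdot>\<^sub>m E) Y Z (0\<^sub>m m m)"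
    unfolding P_def Q_def using E Y Z by (intro eq_matI) auto
  have E': "2 \<cdot>\<^sub>m 1\<^sub>m r + s \<cdot>\<^sub>m E \<in> carrier_mat r r" using E by simp
  have "K * (P + s \<cdot>\<^sub>m Q) = four_block_mat (2 \<cdot>\<^sub>m 1\<^sub>m r + s \<cdot>\<^sub>m E) Y (s \<cdot>\<^sub>m Z) (0\<^sub>m m m)"
    unfolding K_def PQ using E E' Y Z
    by (subst mult_four_block_mat[of _ r r _ m _ m _ _ r _ m])
      (auto intro!: cong_four_block_mat simp: mult_smult_assoc_mat[of _ m m])
  then have "K * (P + s \<cdot>\<^sub>m Q) * K
      = four_block_mat (2 \<cdot>\<^sub>m 1\<^sub>m r + s \<cdot>\<^sub>m E) (s \<cdot>\<^sub>m Y) (s \<cdot>\<^sub>m Z) (0\<^sub>m m m)"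
    unfolding K_def using E E' Y Z
    by (simp only:, subst mult_four_block_mat[of _ r r _ m _ m _ _ r _ m])
      (auto intro!: cong_four_block_mat simp: mult_smult_distrib[of _ r m])
  moreover have "det (K * (P + s \<cdot>\<^sub>m Q) * K) \<noteq> 0"
    using K P Q dK s(2) by (simp add: det_mult[of _ "r + m"])
  ultimately show ?thesis using that by metis
qed

section \<open>Compression to the last \<open>m\<close> coordinates\<close>

text \<open>The last \<open>m\<close> coordinates span the kernel of \<open>unit_block r m\<close>
  and represent its cokernel, so this block is the compression from kernel to cokernel.\<close>

definition corner :: "nat \<Rightarrow> nat \<Rightarrow> 'k mat \<Rightarrow> 'k mat" where
  "corner r m M = mat m m (\<lambda>(i, j). M $$ (r + i, r + j))"

lemma corner_carrier [simp]: "corner r m M \<in> carrier_mat m m"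
  unfolding corner_def by simp

lemma corner_four_block [simp]:
  "A \<in> carrier_mat r r \<Longrightarrow> D \<in> carrier_mat m m \<Longrightarrow> corner r m (four_block_mat A B C D) = D"
  unfolding corner_def by (rule eq_matI) auto

lemma corner_pencil:
  assumes "P \<in> carrier_mat (r + m) (r + m)" "Q \<in> carrier_mat (r + m) (r + m)"
  shows "corner r m (P + t \<cdot>\<^sub>m Q) = corner r m P + t \<cdot>\<^sub>m corner r m Q"
  unfolding corner_def using assms by (intro eq_matI) auto

lemma corner_one [simp]: "corner r m (1\<^sub>m (r + m)) = 1\<^sub>m m"
  unfolding corner_def by (rule eq_matI) auto

lemma four_block_cases:
  assumes "M \<in> carrier_mat (r + m) (r + m)"
  obtains a b c d where "a \<in> carrier_mat r r" "b \<in> carrier_mat r m" "c \<in> carrier_mat m r"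
    "d \<in> carrier_mat m m" "M = four_block_mat a b c d"
  using split_block[of M r r _ _ _ _ m m] assms by (cases "split_block M r r") auto

definition corner_unit :: "nat \<Rightarrow> nat \<Rightarrow> 'k :: field mat" where
  "corner_unit r m = four_block_mat (0\<^sub>m r r) (0\<^sub>m r m) (0\<^sub>m m r) (1\<^sub>m m)"

lemma corner_unit_carrier [simp]: "corner_unit r m \<in> carrier_mat (r + m) (r + m)"
  unfolding corner_unit_def by simp

text \<open>The factor \<open>corner_unit\<close> lets square matrices \<open>A\<close> and \<open>B\<close> stand for the \<open>n \<times> m\<close> and \<open>m \<times> n\<close>
  matrices formed by their last \<open>m\<close> columns and rows.\<close>
lemma corner_compress:
  fixes A T B :: "'k :: field mat"
  assumes "A \<in> carrier_mat (r + m) (r + m)" "T \<in> carrier_mat (r + m) (r + m)"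
    "B \<in> carrier_mat (r + m) (r + m)"
  shows "corner r m ((A * corner_unit r m) * T * (corner_unit r m * B))
    = corner r m A * corner r m T * corner r m B"
proof -
  obtain a1 a2 a3 a4 where a: "a1 \<in> carrier_mat r r" "a2 \<in> carrier_mat r m" "a3 \<in> carrier_mat m r"
    "a4 \<in> carrier_mat m m" "A = four_block_mat a1 a2 a3 a4" using four_block_cases[OF assms(1)] .
  obtain t1 t2 t3 t4 where t: "t1 \<in> carrier_mat r r" "t2 \<in> carrier_mat r m" "t3 \<in> carrier_mat m r"
    "t4 \<in> carrier_mat m m" "T = four_block_mat t1 t2 t3 t4" using four_block_cases[OF assms(2)] .
  obtain b1 b2 b3 b4 where b: "b1 \<in> carrier_mat r r" "b2 \<in> carrier_mat r m" "b3 \<in> carrier_mat m r"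
    "b4 \<in> carrier_mat m m" "B = four_block_mat b1 b2 b3 b4" using four_block_cases[OF assms(3)] .
  have "A * corner_unit r m = four_block_mat (0\<^sub>m r r) a2 (0\<^sub>m m r) a4"
    unfolding a(5) corner_unit_def using a(1-4)
    by (subst mult_four_block_mat[of _ r r _ m _ m _ _ r _ m]) auto
  moreover have "corner_unit r m * B = four_block_mat (0\<^sub>m r r) (0\<^sub>m r m) b3 b4"
    unfolding b(5) corner_unit_def using b(1-4)
    by (subst mult_four_block_mat[of _ r r _ m _ m _ _ r _ m]) auto
  moreover have "four_block_mat (0\<^sub>m r r) a2 (0\<^sub>m m r) a4 * T
      = four_block_mat (a2 * t3) (a2 * t4) (a4 * t3) (a4 * t4)"
    unfolding t(5) using a(1-4) t(1-4)
    by (subst mult_four_block_mat[of _ r r _ m _ m _ _ r _ m]) auto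
  moreover have "four_block_mat (a2 * t3) (a2 * t4) (a4 * t3) (a4 * t4) * four_block_mat (0\<^sub>m r r) (0\<^sub>m r m) b3 b4
      = four_block_mat (a2 * t4 * b3) (a2 * t4 * b4) (a4 * t4 * b3) (a4 * t4 * b4)"
    using a(1-4) t(1-4) b(1-4)
    by (subst mult_four_block_mat[of _ r r _ m _ m _ _ r _ m]) auto
  moreover have "a2 * t4 * b3 \<in> carrier_mat r r" "a4 * t4 * b4 \<in> carrier_mat m m"
    using a(1-4) t(1-4) b(1-4) by auto
  ultimately show ?thesis
    using a t b by simp
qed

section \<open>Generic choice of the two factors\<close>

text \<open>Both factors are perturbations of the identity, whose corner is nonsingular. The
  direction of each perturbation is chosen so that the corner of the long product has a nonsingular
  leading coefficient: first for \<open>a\<close>, with \<open>T * Ci\<close> in place of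
  \<open>b\<close>, then for \<open>b\<close> with \<open>a\<close> fixed.\<close>

lemma exists_generic_factors:
  fixes C :: "'k :: field mat"
  assumes inf: "infinite (UNIV :: 'k set)" and C: "C \<in> carrier_mat (r + m) (r + m)"
    and "det C \<noteq> 0" and "m \<le> r"
  obtains a b where "a \<in> carrier_mat (r + m) (r + m)" "b \<in> carrier_mat (r + m) (r + m)"
    "det (corner r m a) \<noteq> 0" "det (corner r m b) \<noteq> 0"
    "det (corner r m (b * (C * unit_block r m * C * a))) \<noteq> 0"
proof -
  let ?n = "r + m"
  define D :: "'k mat" where "D = unit_block r m"
  have D: "D \<in> carrier_mat ?n ?n" unfolding D_def by simp
  note assoc = assoc_mult_mat[of _ ?n ?n _ ?n _ ?n]
  obtain Ci where Ci: "Ci \<in> carrier_mat ?n ?n" "C * Ci = 1\<^sub>m ?n" "Ci * C = 1\<^sub>m ?n"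
    using obtain_inverse_mat[OF C assms(3)] .
  \<comment> \<open>Inclusion of \<open>m\<close> coordinates into \<open>r\<close> and the
    projection back, which compose to the identity because \<open>m \<le> r\<close>. Extended to
    \<open>S\<close> and \<open>T\<close>, they route the last \<open>m\<close> coordinates through
    the first \<open>r\<close>, where \<open>D\<close> acts as the identity.\<close>
  define s where "s = (mat r m (\<lambda>(i, j). if i = j then 1 else 0) :: 'k mat)"
  define t where "t = (mat m r (\<lambda>(i, j). if i = j then 1 else 0) :: 'k mat)"
  have st: "s \<in> carrier_mat r m" "t \<in> carrier_mat m r" "t * s = 1\<^sub>m m"
    unfolding s_def t_def using \<open>m \<le> r\<close>
    by (auto simp: scalar_prod_def if_distrib[where f = "(*) _"] intro!: eq_matI cong: if_cong)
  define S where "S = four_block_mat (0\<^sub>m r r) s (0\<^sub>m m r) (0\<^sub>m m m)"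
  define T where "T = four_block_mat (0\<^sub>m r r) (0\<^sub>m r m) t (0\<^sub>m m m)"
  have S: "S \<in> carrier_mat ?n ?n" unfolding S_def by (rule four_block_carrier_mat) auto
  have T: "T \<in> carrier_mat ?n ?n" unfolding T_def by (rule four_block_carrier_mat) auto
  have DS: "D * S = S"
    unfolding S_def D_def unit_block_def using st
    by (subst mult_four_block_mat[of _ r r _ m _ m _ _ r _ m]) auto
  have "T * S = four_block_mat (0\<^sub>m r r) (0\<^sub>m r m) (0\<^sub>m m r) (t * s)"
    unfolding S_def T_def using st(1,2)
    by (subst mult_four_block_mat[of _ r r _ m _ m _ _ r _ m]) auto
  then have TDS: "corner r m (T * (D * S)) = 1\<^sub>m m"
    using st(3) by (simp add: DS)
  have a2: "Ci * S \<in> carrier_mat ?n ?n" and b2: "T * Ci \<in> carrier_mat ?n ?n"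
    using Ci S T by auto
  have TDC: "T * D * C \<in> carrier_mat ?n ?n" using T C D by auto
  have TDS': "T * (D * S) \<in> carrier_mat ?n ?n" using T S D by auto
  \<comment> \<open>The first pencil is the identity at \<open>x = 0\<close>; in the second the
    coefficient of \<open>x\<close> is the identity by \<open>TDS\<close>.\<close>
  have "finite ({x. det (corner r m (1\<^sub>m ?n) + x \<cdot>\<^sub>m corner r m (Ci * S)) = 0}
      \<union> {x. det (corner r m (T * D * C) + x \<cdot>\<^sub>m corner r m (T * (D * S))) = 0})"
    using finite_singular_pencil[of "corner r m (1\<^sub>m ?n)" m "corner r m (Ci * S)"]
      finite_singular_pencil_leading[of "corner r m (T * D * C)" m "corner r m (T * (D * S))"]
    by (simp add: TDS)
  from ex_new_if_finite[OF inf this] obtain x where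
    x: "det (corner r m (1\<^sub>m ?n) + x \<cdot>\<^sub>m corner r m (Ci * S)) \<noteq> 0"
      "det (corner r m (T * D * C) + x \<cdot>\<^sub>m corner r m (T * (D * S))) \<noteq> 0"
    by blast
  define a where "a = 1\<^sub>m ?n + x \<cdot>\<^sub>m (Ci * S)"
  have a: "a \<in> carrier_mat ?n ?n" unfolding a_def using a2 by simp
  have "det (corner r m a) \<noteq> 0"
    unfolding a_def using x(1) by (simp only: corner_pencil[OF one_carrier_mat a2] simp_thms)
  have "T * D * C * a = T * D * C + x \<cdot>\<^sub>m (T * D * C * (Ci * S))"
    unfolding a_def mult_add_distrib_mat[OF TDC one_carrier_mat smult_carrier_mat[OF a2]]
      mult_smult_distrib[OF TDC a2] right_mult_one_mat[OF TDC] ..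
  also have "T * D * C * (Ci * S) = T * D * (C * Ci * S)"
    using T C Ci(1) S D by (simp add: assoc)
  also have "\<dots> = T * (D * S)"
    using T S D by (simp add: Ci(2) assoc)
  finally have "det (corner r m (T * D * C * a)) \<noteq> 0"
    using x(2) by (simp only: corner_pencil[OF TDC TDS'] simp_thms)
  moreover define M where "M = C * D * C * a"
  have M: "M \<in> carrier_mat ?n ?n" unfolding M_def using C a D by auto
  \<comment> \<open>The inverse cancels the leading \<open>C\<close> of \<open>M\<close>, leaving
    the product whose corner was made nonsingular by the choice of \<open>x\<close>.\<close>
  have "T * Ci * M = T * (Ci * C) * D * C * a"
    unfolding M_def using T C a Ci(1) D by (simp add: assoc)
  then have "T * Ci * M = T * D * C * a"
    using T by (simp add: Ci(3))
  ultimately have b2M: "det (corner r m (T * Ci * M)) \<noteq> 0" by simp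
  have b2M': "T * Ci * M \<in> carrier_mat ?n ?n" using b2 M by simp
  have "finite ({x. det (corner r m (1\<^sub>m ?n) + x \<cdot>\<^sub>m corner r m (T * Ci)) = 0}
      \<union> {x. det (corner r m M + x \<cdot>\<^sub>m corner r m (T * Ci * M)) = 0})"
    using finite_singular_pencil[of "corner r m (1\<^sub>m ?n)" m "corner r m (T * Ci)"]
      finite_singular_pencil_leading[of "corner r m M" m "corner r m (T * Ci * M)"] b2M
    by simp
  from ex_new_if_finite[OF inf this] obtain y where
    y: "det (corner r m (1\<^sub>m ?n) + y \<cdot>\<^sub>m corner r m (T * Ci)) \<noteq> 0"
      "det (corner r m M + y \<cdot>\<^sub>m corner r m (T * Ci * M)) \<noteq> 0"
    by blast
  define b where "b = 1\<^sub>m ?n + y \<cdot>\<^sub>m (T * Ci)"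
  have b: "b \<in> carrier_mat ?n ?n" unfolding b_def using b2 by simp
  have "det (corner r m b) \<noteq> 0"
    unfolding b_def using y(1) by (simp only: corner_pencil[OF one_carrier_mat b2] simp_thms)
  have "b * M = M + y \<cdot>\<^sub>m (T * Ci * M)"
    unfolding b_def using M b2
    by (simp add: add_mult_distrib_mat[of _ ?n ?n _ _ ?n] mult_smult_assoc_mat[of _ ?n ?n _ ?n])
  then have "det (corner r m (b * M)) \<noteq> 0"
    using y(2) by (simp only: corner_pencil[OF M b2M'] simp_thms)
  then show ?thesis
    using that[OF a b] \<open>det (corner r m a) \<noteq> 0\<close> \<open>det (corner r m b) \<noteq> 0\<close> unfolding M_def D_def by blast
qed

section \<open>The perturbed identity for \<open>A = D C\<close>\<close>

text \<open>For \<open>X = I + s L C\<close> the factor \<open>C\<close> splits off on the right: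
  \<open>D C X + X D C = N C\<close> with \<open>N = 2 D + s (D C L + L C D)\<close>. The lower
  right block of \<open>N\<close> vanishes, so \<open>N\<close> is a bordered pencil as in
  \<open>det_bordered_pencil\<close>.\<close>

lemma exists_lyapunov_unit_block:
  fixes C :: "'k :: field mat"
  assumes inf: "infinite (UNIV :: 'k set)" and two: "(2 :: 'k) \<noteq> 0"
    and C: "C \<in> carrier_mat (r + m) (r + m)" and "det C \<noteq> 0" and "m \<le> r"
  obtains X where "X \<in> carrier_mat (r + m) (r + m)"
    "det (unit_block r m * C * X + X * (unit_block r m * C)) \<noteq> 0"
proof -
  let ?n = "r + m"
  define D :: "'k mat" where "D = unit_block r m"
  have D: "D \<in> carrier_mat ?n ?n" unfolding D_def by simp
  let ?E = "corner_unit r m :: 'k mat"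
  note assoc = assoc_mult_mat[of _ ?n ?n _ ?n _ ?n]
  obtain a b where a: "a \<in> carrier_mat ?n ?n" and b: "b \<in> carrier_mat ?n ?n"
    and ab: "det (corner r m a) \<noteq> 0" "det (corner r m b) \<noteq> 0"
      "det (corner r m (b * (C * D * C * a))) \<noteq> 0"
    using exists_generic_factors[OF inf C assms(4,5), folded D_def] .
  \<comment> \<open>The product of the last \<open>m\<close> columns of \<open>a\<close> with the
    last \<open>m\<close> rows of \<open>b\<close>.\<close>
  define L where "L = a * ?E * b"
  have L: "L \<in> carrier_mat ?n ?n" unfolding L_def using a b corner_unit_carrier[of r m] by (metis mult_carrier_mat)
  have LC: "L * C \<in> carrier_mat ?n ?n" and CL: "C * L \<in> carrier_mat ?n ?n" using L C by auto
  obtain y1 y2 y3 y4 where y: "y1 \<in> carrier_mat r r" "y2 \<in> carrier_mat r m" "y3 \<in> carrier_mat m r"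
    "y4 \<in> carrier_mat m m" "C * L = four_block_mat y1 y2 y3 y4" using four_block_cases[OF CL] .
  obtain z1 z2 z3 z4 where z: "z1 \<in> carrier_mat r r" "z2 \<in> carrier_mat r m" "z3 \<in> carrier_mat m r"
    "z4 \<in> carrier_mat m m" "L * C = four_block_mat z1 z2 z3 z4" using four_block_cases[OF LC] .
  have ZD: "L * C * D = four_block_mat z1 (0\<^sub>m r m) z3 (0\<^sub>m m m)"
    unfolding z(5) D_def unit_block_def using z(1-4)
    by (subst mult_four_block_mat[of _ r r _ m _ m _ _ r _ m]) auto
  have DY: "D * (C * L) = four_block_mat y1 y2 (0\<^sub>m m r) (0\<^sub>m m m)"
    unfolding y(5) D_def unit_block_def using y(1-4)
    by (subst mult_four_block_mat[of _ r r _ m _ m _ _ r _ m]) auto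
  \<comment> \<open>Since \<open>D\<close> keeps only the first \<open>r\<close> inner coordinates,
    the corner of this product is exactly \<open>z3 * y2\<close>, the product of the borders of
    \<open>N\<close> without their factors \<open>s\<close>. Regrouped around
    \<open>L = a * ?E * b\<close>, the same corner splits into three \<open>m\<close> by
    \<open>m\<close> factors.\<close>
  have "L * C * D * (C * L) = four_block_mat (z1 * y1) (z1 * y2) (z3 * y1) (z3 * y2)"
    unfolding ZD unfolding y(5) using y(1-4) z(1-4)
    by (subst mult_four_block_mat[of _ r r _ m _ m _ _ r _ m]) auto
  then have "corner r m (L * C * D * (C * L)) = z3 * y2"
    using y z by simp
  moreover have "(a * E * b) * C * D * (C * (a * E * b)) = (a * E) * (b * (C * D * C * a)) * (E * b)"
    if "E \<in> carrier_mat ?n ?n" for E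
    using that D a b C by (simp add: assoc)
  then have "L * C * D * (C * L) = (a * ?E) * (b * (C * D * C * a)) * (?E * b)"
    unfolding L_def by simp
  moreover have "corner r m ((a * ?E) * (b * (C * D * C * a)) * (?E * b))
      = corner r m a * corner r m (b * (C * D * C * a)) * corner r m b"
    using a b C D by (intro corner_compress) auto
  ultimately have "z3 * y2 = corner r m a * corner r m (b * (C * D * C * a)) * corner r m b"
    by simp
  then have "det (z3 * y2) \<noteq> 0"
    using ab by (simp add: det_mult[OF mult_carrier_mat[OF corner_carrier corner_carrier] corner_carrier]
        det_mult[OF corner_carrier corner_carrier])
  then obtain s where
    s: "det (four_block_mat (2 \<cdot>\<^sub>m 1\<^sub>m r + s \<cdot>\<^sub>m (y1 + z1)) (s \<cdot>\<^sub>m y2) (s \<cdot>\<^sub>m z3) (0\<^sub>m m m)) \<noteq> 0"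
    using det_bordered_pencil[OF inf two _ y(2) z(3), of "y1 + z1"] y z by (metis add_carrier_mat)
  define N where "N = 2 \<cdot>\<^sub>m D + s \<cdot>\<^sub>m (D * (C * L) + L * C * D)"
  have "N = four_block_mat (2 \<cdot>\<^sub>m 1\<^sub>m r + s \<cdot>\<^sub>m (y1 + z1)) (s \<cdot>\<^sub>m y2) (s \<cdot>\<^sub>m z3) (0\<^sub>m m m)"
    unfolding N_def ZD DY unfolding D_def unit_block_def using y(1-4) z(1-4) by (intro eq_matI) auto
  with s have dN: "det N \<noteq> 0" by simp
  have N: "N \<in> carrier_mat ?n ?n" unfolding N_def using L C D by simp
  define X where "X = 1\<^sub>m ?n + s \<cdot>\<^sub>m (L * C)"
  have X: "X \<in> carrier_mat ?n ?n" unfolding X_def using LC by simp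
  have DC: "D * C \<in> carrier_mat ?n ?n" using C D by simp
  have "D * C * X = D * C + s \<cdot>\<^sub>m (D * (C * L) * C)"
    unfolding X_def using DC LC C L D
    by (simp add: mult_add_distrib_mat[of _ ?n ?n _ ?n] mult_smult_distrib[of _ ?n ?n _ ?n] assoc)
  moreover have "X * (D * C) = D * C + s \<cdot>\<^sub>m (L * C * D * C)"
    unfolding X_def using DC LC C L D
    by (simp add: add_mult_distrib_mat[of _ ?n ?n _ _ ?n] mult_smult_assoc_mat[of _ ?n ?n _ ?n] assoc)
  moreover have "N * C = 2 \<cdot>\<^sub>m (D * C) + s \<cdot>\<^sub>m (D * (C * L) * C + L * C * D * C)"
  proof -
    have u: "D * (C * L) \<in> carrier_mat ?n ?n" and v: "L * C * D \<in> carrier_mat ?n ?n"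
      using C L D by auto
    show ?thesis
      unfolding N_def add_mult_distrib_mat[OF smult_carrier_mat[OF D] smult_carrier_mat[OF add_carrier_mat[OF v]] C]
        mult_smult_assoc_mat[OF D C] mult_smult_assoc_mat[OF add_carrier_mat[OF v] C]
        add_mult_distrib_mat[OF u v C] ..
  qed
  moreover have comb: "W + s \<cdot>\<^sub>m U + (W + s \<cdot>\<^sub>m V) = 2 \<cdot>\<^sub>m W + s \<cdot>\<^sub>m (U + V)"
    if "W \<in> carrier_mat ?n ?n" "U \<in> carrier_mat ?n ?n" "V \<in> carrier_mat ?n ?n" for W U V
    using that by (intro eq_matI) (auto simp: algebra_simps)
  ultimately have "D * C * X + X * (D * C) = N * C"
    using comb[OF DC, of "D * (C * L) * C" "L * C * D * C"] C L D by (simp only: mult_carrier_mat[of _ ?n ?n _ ?n])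
  then have "det (D * C * X + X * (D * C)) \<noteq> 0"
    using dN assms(4) N C by (simp add: det_mult[of _ ?n])
  then show ?thesis using that[OF X] unfolding D_def by blast
qed

section \<open>Transport to an arbitrary \<open>A\<close> by similarity\<close>

lemma exists_lyapunov:
  fixes A :: "'k :: field mat"
  assumes inf: "infinite (UNIV :: 'k set)" and two: "(2 :: 'k) \<noteq> 0"
    and A: "A \<in> carrier_mat n n" and rank: "n \<le> 2 * vec_space.rank n A"
  obtains X where "X \<in> carrier_mat n n" "det (A * X + X * A) \<noteq> 0"
proof -
  note assoc = assoc_mult_mat[of _ n n _ n _ n]
  obtain U V r m where n: "n = r + m" and UV: "U \<in> carrier_mat n n" "V \<in> carrier_mat n n"
    "det U \<noteq> 0" "det V \<noteq> 0" "U * A * V = unit_block r m"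
    using equivalent_unit_block[OF A] .
  have D: "(unit_block r m :: 'k mat) \<in> carrier_mat n n" unfolding n by simp
  obtain U' where U': "U' \<in> carrier_mat n n" "U * U' = 1\<^sub>m n" "U' * U = 1\<^sub>m n"
    using obtain_inverse_mat[OF UV(1,3)] .
  obtain V' where V': "V' \<in> carrier_mat n n" "V * V' = 1\<^sub>m n" "V' * V = 1\<^sub>m n"
    using obtain_inverse_mat[OF UV(2,4)] .
  have "U' * (U * A * V) * V' = (U' * U) * A * (V * V')"
    using UV(1,2) U'(1) V'(1) A by (simp add: assoc)
  then have A_eq: "A = U' * unit_block r m * V'"
    using A by (simp add: U'(3) V'(2) UV(5))
  have "vec_space.rank n A \<le> r"
    using rank_unit_block_le[of U' r m V' n] U'(1) V'(1) unfolding A_eq n by simp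
  \<comment> \<open>Here \<open>r + m = n\<close>, while \<open>n\<close> is at most twice the rank
    and hence at most \<open>2 r\<close>.\<close>
  then have "m \<le> r" using rank n by simp
  \<comment> \<open>As \<open>U'\<close> inverts \<open>U\<close>, the equivalence
    \<open>A = U' D V'\<close> becomes the similarity \<open>A = U' (D C) U\<close>; a solution
    \<open>X\<close> for \<open>D C\<close> then gives \<open>U' X U\<close> for
    \<open>A\<close>.\<close>
  define C where "C = V' * U'"
  have C: "C \<in> carrier_mat n n" unfolding C_def using U'(1) V'(1) by simp
  have dUV: "det U' \<noteq> 0" "det V' \<noteq> 0"
    using det_mult[OF UV(1) U'(1)] det_mult[OF UV(2) V'(1)] U'(2) V'(2) by auto
  then have "det C \<noteq> 0"
    unfolding C_def using U'(1) V'(1) by (simp add: det_mult[of _ n])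
  then obtain X where X: "X \<in> carrier_mat n n"
    "det (unit_block r m * C * X + X * (unit_block r m * C)) \<noteq> 0"
    using exists_lyapunov_unit_block[OF inf two, of C r m] C \<open>m \<le> r\<close> unfolding n by metis
  define F where "F = unit_block r m * C"
  have F: "F \<in> carrier_mat n n" unfolding F_def using D C by simp
  have "U' * F * U = U' * unit_block r m * V' * (U' * U)"
    unfolding F_def C_def using U'(1) V'(1) UV(1) D by (simp add: assoc)
  then have A_F: "A = U' * F * U"
    using U'(1) V'(1) D by (simp add: A_eq U'(3) right_mult_one_mat[of _ n n])
  have "A * (U' * X * U) = U' * F * (U * U') * X * U"
    unfolding A_F using U'(1) F X(1) UV(1) by (simp add: assoc)
  also have "\<dots> = U' * (F * X) * U"
    using U'(1) F X(1) UV(1) by (simp add: U'(2) assoc)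
  finally have 1: "A * (U' * X * U) = U' * (F * X) * U" .
  have "(U' * X * U) * A = U' * X * (U * U') * F * U"
    unfolding A_F using U'(1) F X(1) UV(1) by (simp add: assoc)
  also have "\<dots> = U' * (X * F) * U"
    using U'(1) F X(1) UV(1) by (simp add: U'(2) assoc)
  finally have 2: "(U' * X * U) * A = U' * (X * F) * U" .
  have "A * (U' * X * U) + (U' * X * U) * A = U' * (F * X + X * F) * U"
    unfolding 1 2 using U'(1) F X(1) UV(1)
    by (simp add: mult_add_distrib_mat[of _ n n _ n] add_mult_distrib_mat[of _ n n _ _ n])
  moreover have "det (U' * (F * X + X * F) * U) \<noteq> 0"
    using X F U'(1) UV(1,3) dUV(1) unfolding F_def[symmetric] by (simp add: det_mult[of _ n])
  ultimately show ?thesis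
    using that[of "U' * X * U"] U'(1) X(1) UV(1) by simp
qed

section \<open>From a solution \<open>X\<close> to an invertible conjugator\<close>

theorem theorem1:
  fixes n :: nat and A :: "'k :: field mat"
  assumes "n \<ge> 2"
    and "infinite (UNIV :: 'k set)"
    and "CHAR('k) \<noteq> 2"
    and "A \<in> carrier_mat n n"
    and "real (vec_space.rank n A) \<ge> real n / 2"
  shows "\<exists>B \<in> carrier_mat n n. similar_mat B A \<and> invertible_mat (A + B)"
proof -
  note A = assms(4) and assoc = assoc_mult_mat[of _ n n _ n _ n]
  have two: "(2 :: 'k) \<noteq> 0"
  proof
    assume "(2 :: 'k) = 0"
    then have "CHAR('k) dvd 2"
      using of_nat_eq_0_iff_char_dvd[of 2, where 'a = 'k] by simp
    then have "CHAR('k) = 1"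
      using assms(3) two_is_prime_nat unfolding prime_nat_iff by blast
    then show False
      using CHAR_not_1 by simp
  qed
  have "n \<le> 2 * vec_space.rank n A" using assms(5) by linarith
  then obtain X where X: "X \<in> carrier_mat n n" "det (A * X + X * A) \<noteq> 0"
    using exists_lyapunov[OF assms(2) two A] by blast
  have AX: "A * X + X * A \<in> carrier_mat n n" using A X by simp
  \<comment> \<open>Replacing \<open>X\<close> by \<open>X + u I\<close> adds \<open>2 u A\<close>
    to \<open>A X + X A\<close>. The first pencil has leading coefficient \<open>I\<close>, the
    second is nonsingular at \<open>u = 0\<close>, so some \<open>u\<close> makes both determinants
    nonzero.\<close>
  have "finite ({u. det (X + u \<cdot>\<^sub>m 1\<^sub>m n) = 0} \<union> {u. det (A * X + X * A + u \<cdot>\<^sub>m (2 \<cdot>\<^sub>m A)) = 0})"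
    using finite_singular_pencil_leading[OF X(1) one_carrier_mat]
      finite_singular_pencil[OF AX _ X(2), of "2 \<cdot>\<^sub>m A"] A by simp
  from ex_new_if_finite[OF assms(2) this] obtain u where
    u: "det (X + u \<cdot>\<^sub>m 1\<^sub>m n) \<noteq> 0" "det (A * X + X * A + u \<cdot>\<^sub>m (2 \<cdot>\<^sub>m A)) \<noteq> 0"
    by blast
  define P where "P = X + u \<cdot>\<^sub>m 1\<^sub>m n"
  have P: "P \<in> carrier_mat n n" unfolding P_def using X by simp
  have "A * P = A * X + u \<cdot>\<^sub>m A" "P * A = X * A + u \<cdot>\<^sub>m A"
    unfolding P_def using A X(1)
    by (simp_all add: mult_add_distrib_mat[of _ n n _ n] mult_smult_distrib[of _ n n _ n]
        add_mult_distrib_mat[of _ n n _ _ n] mult_smult_assoc_mat[of _ n n _ n])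
  then have "A * P + P * A = A * X + X * A + u \<cdot>\<^sub>m (2 \<cdot>\<^sub>m A)"
    using A X(1) by (intro eq_matI) (auto simp: algebra_simps simp del: index_mult_mat(1))
  then have det: "det (A * P + P * A) \<noteq> 0" using u(2) by simp
  obtain Q where Q: "Q \<in> carrier_mat n n" "P * Q = 1\<^sub>m n" "Q * P = 1\<^sub>m n"
    using obtain_inverse_mat[OF P] u(1) unfolding P_def by blast
  have "det Q \<noteq> 0" using det_mult[OF P Q(1)] Q(2) by auto
  \<comment> \<open>With \<open>Q\<close> the inverse of \<open>P\<close>, this turns
    \<open>A P + P A\<close> into \<open>A\<close> plus its conjugate by \<open>P\<close>.\<close>
  have "(A * P + P * A) * Q = A * (P * Q) + P * A * Q"
    using A P Q(1) by (simp add: add_mult_distrib_mat[of _ n n _ _ n] assoc)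
  then have sum: "A + P * A * Q = (A * P + P * A) * Q"
    using A by (simp add: Q(2))
  have "det (A + P * A * Q) \<noteq> 0"
    unfolding sum using A P Q(1) det \<open>det Q \<noteq> 0\<close> by (simp add: det_mult[of _ n])
  moreover have S: "A + P * A * Q \<in> carrier_mat n n" using A P Q(1) by simp
  ultimately have "invertible_mat (A + P * A * Q)"
    by (intro invertible_mat_if_det_nonzero)
  moreover have "similar_mat (P * A * Q) A"
    by (rule similar_matI[of _ _ P Q n]) (use A P Q in auto)
  ultimately show ?thesis
    using A P Q(1) by (intro bexI[of _ "P * A * Q"]) auto
qed

end
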